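(* Let $T\subset\mathbb{R}^2$ be a nondegenerate triangle and let $\mathcal{F}^{\mathrm{enr}}_1,\mathcal{F}^{\mathrm{enr}}_2,\mathcal{F}^{\mathrm{enr}}_3: C(T)\to\mathbb{R}$ be linear functionals. The triple $\mathcal{S}=(T,\mathbb{P}_2(T),\Sigma_T^{\mathrm{enr}})$, with $\Sigma_T^{\mathrm{enr}}=\{\mathcal{I}_j^{\mathrm{CR}},\mathcal{F}_j^{\mathrm{enr}} : j=1,2,3\}$, is a finite element if and only if the $3\times 3$ matrix $N=\left[\mathcal{F}_j^{\mathrm{enr}}(\varphi_i)\right]_{j,i=1,2,3}$ (row index $j$, column index $i$) is nonsingular.
   Context: $T$ has vertices $\boldsymbol{v}_1,\boldsymbol{v}_2,\boldsymbol{v}_3$ (oriented counterclockwise) and barycentric coordinates $\lambda_1,\lambda_2,\lambda_3$; indices are cyclic: $\boldsymbol{v}_4=\boldsymbol{v}_1$, $\boldsymbol{v}_5=\boldsymbol{v}_2$. $C(T)$ is the space of continuous real functions on $T$. $\mathbb{P}_2(T)=\operatorname{span}\{\lambda_1,\lambda_2,\lambda_3,\lambda_1^2,\lambda_2^2,\lambda_3^2\}$ is the space of bivariate polynomials of degree at most $2$ restricted to $T$. The Crouzeix--Raviart functionals are the edge means $$\mathcal{I}_j^{\mathrm{CR}}(f)=\int_0^1 f\left(t\boldsymbol{v}_{j+1}+(1-t)\boldsymbol{v}_{j+2}\right)dt,\qquad j=1,2,3.$$ The functions $\varphi_i\in\mathbb{P}_2(T)$ are $$\varphi_1=\lambda_1(1-3\lambda_2-3\lambda_3),\quad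 \varphi_2=\lambda_2(1-3\lambda_1-3\lambda_3),\quad \varphi_3=\lambda_3(1-3\lambda_1-3\lambda_2).$$ The triple $\mathcal{S}$ is called a finite element if the only $p\in\mathbb{P}_2(T)$ with $\mathcal{I}_j^{\mathrm{CR}}(p)=0$ and $\mathcal{F}_j^{\mathrm{enr}}(p)=0$ for all $j=1,2,3$ is $p=0$. *)

theory Defs
  imports "HOL-Analysis.Analysis"
begin

text \<open>
  Vertices are indexed by the type \<^typ>\<open>3\<close>, whose arithmetic is modulo 3, so that
  \<open>v 4 = v 1\<close> and \<open>v 5 = v 2\<close> hold by construction (and \<open>3 = 0\<close>).
  Functions on a set \<open>T\<close> are represented by extensional functions
  (\<^const>\<open>undefined\<close> outside \<open>T\<close>), so that equality of functions is equality on \<open>T\<close>.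
\<close>

definition triangle_of :: "(3 \<Rightarrow> real^2) \<Rightarrow> (real^2) set" where
  "triangle_of v = convex hull (range v)"

definition counterclockwise :: "(3 \<Rightarrow> real^2) \<Rightarrow> bool" where
  "counterclockwise v \<longleftrightarrow> det (vector [v 2 - v 1, v 3 - v 1] :: real^2^2) > 0"

text \<open>For nondegenerate \<open>v\<close> the description is uniquely satisfied, see \<open>bary_unique\<close>.\<close>

definition bary :: "(3 \<Rightarrow> real^2) \<Rightarrow> 3 \<Rightarrow> real^2 \<Rightarrow> real" where
  "bary v i x = (THE u. (\<Sum>j\<in>UNIV. u j) = 1 \<and> (\<Sum>j\<in>UNIV. u j *\<^sub>R v j) = x) i"

definition cont_funs :: "(real^2) set \<Rightarrow> (real^2 \<Rightarrow> real) set" where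
  "cont_funs T = {f \<in> extensional T. continuous_on T f}"

definition linear_functional :: "(real^2) set \<Rightarrow> ((real^2 \<Rightarrow> real) \<Rightarrow> real) \<Rightarrow> bool" where
  "linear_functional T L \<longleftrightarrow>
     (\<forall>f\<in>cont_funs T. \<forall>g\<in>cont_funs T. L (\<lambda>x\<in>T. f x + g x) = L f + L g) \<and>
     (\<forall>c. \<forall>f\<in>cont_funs T. L (\<lambda>x\<in>T. c * f x) = c * L f)"

text \<open>The span of the barycentric coordinates and their squares; see \<open>P2_eq_quadratic\<close> below.\<close>

definition P2 :: "(3 \<Rightarrow> real^2) \<Rightarrow> (real^2 \<Rightarrow> real) set" where
  "P2 v = {(\<lambda>x\<in>triangle_of v. \<Sum>i\<in>UNIV. a i * bary v i x + b i * (bary v i x)\<^sup>2) | a b. True}"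

definition I_CR :: "(3 \<Rightarrow> real^2) \<Rightarrow> 3 \<Rightarrow> (real^2 \<Rightarrow> real) \<Rightarrow> real" where
  "I_CR v j f = integral {0..1} (\<lambda>t. f (t *\<^sub>R v (j + 1) + (1 - t) *\<^sub>R v (j + 2)))"

definition \<phi> :: "(3 \<Rightarrow> real^2) \<Rightarrow> 3 \<Rightarrow> real^2 \<Rightarrow> real" where
  "\<phi> v i = (\<lambda>x\<in>triangle_of v. bary v i x * (1 - 3 * bary v (i + 1) x - 3 * bary v (i + 2) x))"

definition finite_element ::
    "(real^2) set \<times> (real^2 \<Rightarrow> real) set \<times> ((real^2 \<Rightarrow> real) \<Rightarrow> real) set \<Rightarrow> bool" where
  "finite_element = (\<lambda>(T, P, \<Sigma>). \<forall>p\<in>P. (\<forall>L\<in>\<Sigma>. L p = 0) \<longrightarrow> p = (\<lambda>x\<in>T. 0))"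

lemma det_vertices:
  "det (vector [v 2 - v 1, v 3 - v 1] :: real^2^2) =
     (v 2 - v 1)$1 * (v 3 - v 1)$2 - (v 2 - v (1::3))$2 * (v 3 - v 1)$1"
  by (simp add: det_2 mult.commute)

lemma bary_unique:
  fixes v :: "3 \<Rightarrow> real^2"
  assumes "counterclockwise v"
  shows "\<exists>!u. (\<Sum>j\<in>UNIV. u j) = 1 \<and> (\<Sum>j\<in>UNIV. u j *\<^sub>R v j) = x"
proof -
  define p q r s where "p = (v 2 - v 1)$1" "q = (v 2 - v 1)$2"
    "r = (v 3 - v 1)$1" "s = (v 3 - v 1)$2"
  define D where "D = p * s - q * r"
  define y z where "y = (x - v 1)$1" and "z = (x - v 1)$2"
  have D: "D \<noteq> 0"
    using assms unfolding counterclockwise_def det_vertices D_def p_q_r_s_def by simp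
  have char: "(\<Sum>j\<in>UNIV. u j) = 1 \<and> (\<Sum>j\<in>UNIV. u j *\<^sub>R v j) = x \<longleftrightarrow>
      u 1 = 1 - u 2 - u 3 \<and> u 2 = (y * s - z * r) / D \<and> u 3 = (p * z - q * y) / D"
    for u :: "3 \<Rightarrow> real"
  proof -
    have "(\<Sum>j\<in>UNIV. u j) = 1 \<and> (\<Sum>j\<in>UNIV. u j *\<^sub>R v j) = x \<longleftrightarrow>
      u 1 = 1 - u 2 - u 3 \<and> u 2 * p + u 3 * r = y \<and> u 2 * q + u 3 * s = z"
    proof (cases "u 1 = 1 - u 2 - u 3")
      case True
      show ?thesis unfolding p_q_r_s_def y_def z_def sum_3 vec_eq_iff forall_2 True
        by (simp add: algebra_simps)
    qed (auto simp: sum_3)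
    also have "u 2 * p + u 3 * r = y \<and> u 2 * q + u 3 * s = z \<longleftrightarrow>
      u 2 * D = y * s - z * r \<and> u 3 * D = p * z - q * y" (is "?L \<longleftrightarrow> ?R")
    proof
      assume ?L then show ?R unfolding D_def by (auto simp: algebra_simps)
    next
      assume R: ?R
      then have "(u 2 * p + u 3 * r) * D = y * D" "(u 2 * q + u 3 * s) * D = z * D"
        unfolding D_def by algebra+
      with D show ?L by simp
    qed
    finally show ?thesis using D by (simp add: field_simps)
  qed
  show ?thesis
    unfolding char
  proof (rule ex1I)
    let ?b = "(y * s - z * r) / D" and ?c = "(p * z - q * y) / D"
    let ?u = "\<lambda>j::3. if j = 2 then ?b else if j = 3 then ?c else 1 - ?b - ?c"
    show "?u 1 = 1 - ?u 2 - ?u 3 \<and> ?u 2 = ?b \<and> ?u 3 = ?c" by simp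
    fix u :: "3 \<Rightarrow> real"
    assume "u 1 = 1 - u 2 - u 3 \<and> u 2 = ?b \<and> u 3 = ?c"
    then show "u = ?u"
      unfolding fun_eq_iff forall_3 by auto
  qed
qed

lemma bary_props:
  assumes "counterclockwise v"
  shows "(\<Sum>j\<in>UNIV. bary v j x) = 1" "(\<Sum>j\<in>UNIV. bary v j x *\<^sub>R v j) = x"
  using theI'[OF bary_unique[OF assms, of x]] unfolding bary_def by auto

lemma bary_explicit:
  assumes ccw: "counterclockwise v"
  defines "D \<equiv> det (vector [v 2 - v 1, v 3 - v 1] :: real^2^2)"
  shows "bary v 1 x = 1 - bary v 2 x - bary v 3 x"
    and "bary v 2 x = ((x - v 1)$1 * (v 3 - v 1)$2 - (x - v 1)$2 * (v 3 - v 1)$1) / D"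
    and "bary v 3 x = ((v 2 - v 1)$1 * (x - v 1)$2 - (v 2 - v 1)$2 * (x - v 1)$1) / D"
proof -
  note S = bary_props(1)[OF ccw, of x, unfolded sum_3]
  show b1: "bary v 1 x = 1 - bary v 2 x - bary v 3 x" using S by simp
  have "x - v 1 = bary v 2 x *\<^sub>R (v 2 - v 1) + bary v 3 x *\<^sub>R (v 3 - v 1)"
    using bary_props(2)[OF ccw, of x, unfolded sum_3] b1 by (simp add: algebra_simps)
  then have E: "(x - v 1)$k = bary v 2 x * (v 2 - v 1)$k + bary v 3 x * (v 3 - v 1)$k" for k
    by (metis vector_add_component vector_scaleR_component real_scaleR_def)
  have D: "D \<noteq> 0" using ccw unfolding counterclockwise_def D_def by simp
  have "bary v 2 x * D = (x - v 1)$1 * (v 3 - v 1)$2 - (x - v 1)$2 * (v 3 - v 1)$1"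
    unfolding E D_def det_vertices by algebra
  with D show "bary v 2 x = ((x - v 1)$1 * (v 3 - v 1)$2 - (x - v 1)$2 * (v 3 - v 1)$1) / D"
    by (simp add: field_simps)
  have "bary v 3 x * D = (v 2 - v 1)$1 * (x - v 1)$2 - (v 2 - v 1)$2 * (x - v 1)$1"
    unfolding E D_def det_vertices by algebra
  with D show "bary v 3 x = ((v 2 - v 1)$1 * (x - v 1)$2 - (v 2 - v 1)$2 * (x - v 1)$1) / D"
    by (simp add: field_simps)
qed

lemma P2_eq_quadratic:
  assumes ccw: "counterclockwise v"
  shows "P2 v = {(\<lambda>x\<in>triangle_of v. c0 + c1 * x$1 + c2 * x$2 +
            c3 * (x$1)\<^sup>2 + c4 * (x$1 * x$2) + c5 * (x$2)\<^sup>2) | c0 c1 c2 c3 c4 c5. True}"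
    (is "_ = ?Q")
proof
  have lin: "\<exists>d e g. \<forall>x. bary v i x = d + e * x$1 + g * x$2" for i
  proof -
    define D where "D = det (vector [v 2 - v 1, v 3 - v 1] :: real^2^2)"
    define p q r s where "p = (v 2 - v 1)$1 / D" "q = (v 2 - v 1)$2 / D"
      "r = (v 3 - v 1)$1 / D" "s = (v 3 - v 1)$2 / D"
    have b2: "bary v 2 x = (v 1$2 * r - v 1$1 * s) + s * x$1 + (- r) * x$2" for x
      unfolding bary_explicit(2)[OF ccw] D_def[symmetric] p_q_r_s_def
      by (simp add: field_simps flip: add_divide_distrib diff_divide_distrib)
    have b3: "bary v 3 x = (v 1$1 * q - v 1$2 * p) + (- q) * x$1 + p * x$2" for x
      unfolding bary_explicit(3)[OF ccw] D_def[symmetric] p_q_r_s_def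
      by (simp add: field_simps flip: add_divide_distrib diff_divide_distrib)
    have b1: "bary v 1 x = (1 - (v 1$2 * r - v 1$1 * s) - (v 1$1 * q - v 1$2 * p))
        + (q - s) * x$1 + (r - p) * x$2" for x
      unfolding bary_explicit(1)[OF ccw] b2 b3 by (simp add: algebra_simps)
    show ?thesis using exhaust_3[of i] b1 b2 b3 by metis
  qed
  then obtain d e g where deg: "\<And>i x. bary v i x = d i + e i * x$1 + g i * x$2" by metis
  show "P2 v \<subseteq> ?Q"
  proof
    fix p assume "p \<in> P2 v"
    then obtain a b where p:
      "p = (\<lambda>x\<in>triangle_of v. \<Sum>i\<in>UNIV. a i * bary v i x + b i * (bary v i x)\<^sup>2)"
      unfolding P2_def by blast
    have "(\<Sum>i\<in>UNIV. a i * bary v i x + b i * (bary v i x)\<^sup>2) =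
      (\<Sum>i\<in>UNIV. a i * d i + b i * (d i)\<^sup>2) + (\<Sum>i\<in>UNIV. a i * e i + 2 * b i * d i * e i) * x$1
      + (\<Sum>i\<in>UNIV. a i * g i + 2 * b i * d i * g i) * x$2 + (\<Sum>i\<in>UNIV. b i * (e i)\<^sup>2) * (x$1)\<^sup>2
      + (\<Sum>i\<in>UNIV. 2 * b i * e i * g i) * (x$1 * x$2) + (\<Sum>i\<in>UNIV. b i * (g i)\<^sup>2) * (x$2)\<^sup>2" for x
      unfolding deg sum_3 by (simp add: power2_eq_square algebra_simps)
    then show "p \<in> ?Q"
      unfolding p mem_Collect_eq by (intro exI conjI TrueI restrict_ext)
  qed
  show "?Q \<subseteq> P2 v"
  proof
    fix p assume "p \<in> ?Q"
    then obtain c0 c1 c2 c3 c4 c5 where p: "p = (\<lambda>x\<in>triangle_of v. c0 + c1 * x$1 + c2 * x$2 +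
            c3 * (x$1)\<^sup>2 + c4 * (x$1 * x$2) + c5 * (x$2)\<^sup>2)" by blast
    define h where "h = (\<lambda>i j. c3 * (v i$1 * v j$1) + c4 / 2 * (v i$1 * v j$2 + v i$2 * v j$1)
        + c5 * (v i$2 * v j$2))"
    define l where "l = (\<lambda>i. c0 + c1 * v i$1 + c2 * v i$2)"
    define a where "a = (\<lambda>i. l i + h i (i+1) + h i (i+2) - h (i+1) (i+2))"
    define b where "b = (\<lambda>i. h i i - h i (i+1) - h i (i+2) + h (i+1) (i+2))"
    have "c0 + c1 * x$1 + c2 * x$2 + c3 * (x$1)\<^sup>2 + c4 * (x$1 * x$2) + c5 * (x$2)\<^sup>2 =
      (\<Sum>i\<in>UNIV. a i * bary v i x + b i * (bary v i x)\<^sup>2)" for x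
    proof -
      have co: "x$k = bary v 1 x * v 1$k + bary v 2 x * v 2$k + bary v 3 x * v 3$k" for k
        using arg_cong[OF bary_props(2)[OF ccw, of x, unfolded sum_3], of "\<lambda>y. y$k"] by simp
      have ix: "(1::3)+1=2" "(1::3)+2=3" "(2::3)+1=3" "(2::3)+2=1" "(3::3)+1=1" "(3::3)+2=2"
        by simp_all
      show ?thesis
        unfolding co sum_3 a_def b_def ix h_def l_def bary_explicit(1)[OF ccw]
        by (simp add: field_simps power2_eq_square)
    qed
    then show "p \<in> P2 v" unfolding p P2_def by auto
  qed
qed

end

theory Submission
  imports Defs
begin

text \<open>
  Since \<open>\<phi>\<^sub>i = 3 \<lambda>\<^sub>i\<^sup>2 - 2 \<lambda>\<^sub>i\<close> has mean zero on every edge, and the edge means of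
  \<open>\<Sum> a\<^sub>i \<lambda>\<^sub>i + b\<^sub>i \<lambda>\<^sub>i\<^sup>2\<close> are the pairwise sums of the numbers \<open>a\<^sub>i / 2 + b\<^sub>i / 3\<close>, the
  common kernel in \<open>P\<^sub>2\<close> of the Crouzeix--Raviart functionals is exactly the span of
  \<open>\<phi>\<^sub>1, \<phi>\<^sub>2, \<phi>\<^sub>3\<close>. These are independent because \<open>\<phi>\<^sub>i (v\<^sub>k) = \<delta>\<^sub>i\<^sub>k\<close>. Hence unisolvence
  says that the matrix \<open>N\<close>, which expresses the enriching functionals on this span,
  has trivial kernel.
\<close>

text \<open>Weights of sum 1 satisfy the description behind \<open>bary\<close>, so uniqueness
  identifies them. Values at vertices and on edges are read off from here.\<close>

lemma bary_affine_combination: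
  assumes "counterclockwise v" "(\<Sum>j\<in>UNIV. u j) = 1"
  shows "bary v i (\<Sum>j\<in>UNIV. u j *\<^sub>R v j) = u i"
  unfolding bary_def
  by (subst the1_equality[OF bary_unique[OF assms(1)]]) (simp_all add: assms(2))

lemma succ_3: "(1::3) + 1 = 2" "(1::3) + 2 = 3" "(2::3) + 1 = 3" "(2::3) + 2 = 1"
  "(3::3) + 1 = 1" "(3::3) + 2 = 2"
  by simp_all

lemma distinct_shifts_3: "j + 1 \<noteq> j" "j + 2 \<noteq> j" "j + 1 \<noteq> j + 2" for j :: 3
  by simp_all

text \<open>Starting the cyclic sum at \<open>j\<close> lets edge \<open>j\<close> and its opposite
  vertex be treated without a case split on \<open>j\<close>.\<close>

lemma sum_3_shift:
  fixes f :: "3 \<Rightarrow> 'a::comm_monoid_add"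
  shows "(\<Sum>i\<in>UNIV. f i) = f j + f (j + 1) + f (j + 2)"
  using exhaust_3[of j] by (elim disjE; simp only: sum_3 succ_3; simp add: add_ac)

lemma bary_vertex:
  assumes "counterclockwise v"
  shows "bary v i (v k) = of_bool (i = k)"
proof -
  have "(\<Sum>j\<in>UNIV. of_bool (j = k) *\<^sub>R v j) = v k"
    unfolding sum_3_shift[of _ k] by (simp add: distinct_shifts_3)
  moreover have "(\<Sum>j\<in>UNIV. of_bool (j = k)) = (1::real)"
    unfolding sum_3_shift[of _ k] by (simp add: distinct_shifts_3)
  ultimately show ?thesis
    using bary_affine_combination[OF assms, of "\<lambda>j. of_bool (j = k)" i] by simp
qed

lemma bary_edge:
  assumes "counterclockwise v"
  shows "bary v j (t *\<^sub>R v (j + 1) + (1 - t) *\<^sub>R v (j + 2)) = 0"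
    and "bary v (j + 1) (t *\<^sub>R v (j + 1) + (1 - t) *\<^sub>R v (j + 2)) = t"
    and "bary v (j + 2) (t *\<^sub>R v (j + 1) + (1 - t) *\<^sub>R v (j + 2)) = 1 - t"
proof -
  define u where "u = (\<lambda>i. if i = j then 0 else if i = j + 1 then t else 1 - t)"
  have u: "u j = 0" "u (j + 1) = t" "u (j + 2) = 1 - t"
    unfolding u_def using distinct_shifts_3[of j] by auto
  have "bary v i (t *\<^sub>R v (j + 1) + (1 - t) *\<^sub>R v (j + 2)) = u i" for i
    using bary_affine_combination[OF assms, of u i]
    by (simp only: sum_3_shift[of _ j] u) simp
  with u show "bary v j (t *\<^sub>R v (j + 1) + (1 - t) *\<^sub>R v (j + 2)) = 0"
    "bary v (j + 1) (t *\<^sub>R v (j + 1) + (1 - t) *\<^sub>R v (j + 2)) = t"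
    "bary v (j + 2) (t *\<^sub>R v (j + 1) + (1 - t) *\<^sub>R v (j + 2)) = 1 - t"
    by simp_all
qed

lemma vertex_in_triangle: "v k \<in> triangle_of v"
  unfolding triangle_of_def by (simp add: hull_inc)

lemma edge_in_triangle:
  assumes "t \<in> {0..1}"
  shows "t *\<^sub>R v i + (1 - t) *\<^sub>R v j \<in> triangle_of v"
proof -
  have "convex (triangle_of v)" unfolding triangle_of_def by (rule convex_convex_hull)
  then show ?thesis using assms by (intro convexD vertex_in_triangle) auto
qed

lemma continuous_on_bary:
  assumes "counterclockwise v"
  shows "continuous_on S (bary v i)"
proof -
  have 2: "continuous_on S (bary v 2)" and 3: "continuous_on S (bary v 3)"
    unfolding bary_explicit(2,3)[OF assms, abs_def] divide_inverse
    by (intro continuous_intros)+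
  moreover have "continuous_on S (bary v 1)"
    unfolding bary_explicit(1)[OF assms, abs_def] by (intro continuous_intros 2 3)
  ultimately show ?thesis using exhaust_3[of i] by auto
qed

text \<open>The coordinates sum to 1, so the second factor of \<open>\<phi> v i\<close> is
  \<open>3 * bary v i x - 2\<close>. Only the \<open>i\<close>-th coordinate remains, in the shape
  of the generators of \<open>P2\<close>.\<close>

lemma phi_eq:
  assumes "counterclockwise v"
  shows "\<phi> v i = (\<lambda>x\<in>triangle_of v. 3 * (bary v i x)\<^sup>2 - 2 * bary v i x)"
proof -
  have s: "bary v (i + 2) x = 1 - bary v i x - bary v (i + 1) x" for x
    using bary_props(1)[OF assms, of x, unfolded sum_3_shift[of _ i]] by simp
  show ?thesis
    unfolding \<phi>_def s by (intro restrict_ext) (simp add: power2_eq_square algebra_simps)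
qed

lemma phi_vertex:
  assumes "counterclockwise v"
  shows "\<phi> v i (v k) = of_bool (i = k)"
  unfolding phi_eq[OF assms] by (simp add: vertex_in_triangle bary_vertex[OF assms])

lemma restrict_in_cont_funs:
  assumes "continuous_on T f"
  shows "restrict f T \<in> cont_funs T"
  using assms unfolding cont_funs_def by (simp cong: continuous_on_cong)

lemma phi_in_cont_funs:
  assumes "counterclockwise v"
  shows "\<phi> v i \<in> cont_funs (triangle_of v)"
  unfolding phi_eq[OF assms]
  by (intro restrict_in_cont_funs continuous_intros continuous_on_bary assms)

text \<open>Linearity is available only for extensional continuous functions, so the induction must
  keep every partial sum restricted to \<open>T\<close> and continuous.\<close>

lemma linear_functional_sum:
  assumes L: "linear_functional T L" and f: "\<And>i. i \<in> I \<Longrightarrow> f i \<in> cont_funs T"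
    and "finite I"
  shows "L (\<lambda>x\<in>T. \<Sum>i\<in>I. c i * f i x) = (\<Sum>i\<in>I. c i * L (f i))"
  using \<open>finite I\<close> f
proof (induction I)
  case empty
  \<comment> \<open>The empty sum is handled by homogeneity with scalar 0.\<close>
  have "(\<lambda>x\<in>T. 0) \<in> cont_funs T" by (intro restrict_in_cont_funs continuous_intros)
  then have "L (\<lambda>x\<in>T. 0 * (\<lambda>x\<in>T. 0) x) = 0 * L (\<lambda>x\<in>T. 0)"
    using L unfolding linear_functional_def by blast
  then show ?case by (simp add: restrict_def)
next
  case (insert k I)
  have cont: "continuous_on T (f i)" if "i \<in> insert k I" for i
    using insert.prems[OF that] unfolding cont_funs_def by blast
  let ?g = "\<lambda>x\<in>T. c k * f k x" and ?h = "\<lambda>x\<in>T. \<Sum>i\<in>I. c i * f i x"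
  have "?g \<in> cont_funs T" "?h \<in> cont_funs T"
    using cont by (auto intro!: restrict_in_cont_funs continuous_intros)
  then have "L (\<lambda>x\<in>T. ?g x + ?h x) = L ?g + L ?h"
    using L unfolding linear_functional_def by blast
  moreover have "(\<lambda>x\<in>T. ?g x + ?h x) = (\<lambda>x\<in>T. \<Sum>i\<in>insert k I. c i * f i x)"
    using insert.hyps by (intro restrict_ext) simp
  moreover have "L ?g = c k * L (f k)"
    using L insert.prems[of k] unfolding linear_functional_def by blast
  moreover have "L ?h = (\<Sum>i\<in>I. c i * L (f i))"
    using insert.prems by (intro insert.IH) blast
  ultimately show ?case by (simp only: sum.insert[OF insert.hyps])
qed

text \<open>On edge \<open>j\<close> the coordinates are 0, \<open>t\<close> and
  \<open>1 - t\<close>; both \<open>t\<close> and \<open>1 - t\<close> have mean 1/2, and their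
  squares have mean 1/3.\<close>

lemma I_CR_quadratic:
  assumes "counterclockwise v"
  shows "I_CR v j (\<lambda>x\<in>triangle_of v. \<Sum>i\<in>UNIV. a i * bary v i x + b i * (bary v i x)\<^sup>2)
    = (a (j + 1) / 2 + b (j + 1) / 3) + (a (j + 2) / 2 + b (j + 2) / 3)"
proof -
  define G where "G = (\<lambda>a b t::real. a * t\<^sup>2 / 2 + b * t ^ 3 / 3)"
  have G: "(G a b has_real_derivative a * t + b * t\<^sup>2) (at t)" for a b t
    unfolding G_def by (auto intro!: derivative_eq_intros simp: power2_eq_square)
  \<comment> \<open>The minus sign cancels the inner derivative -1 of \<open>1 - t\<close>.\<close>
  define H where "H = (\<lambda>t. G (a (j + 1)) (b (j + 1)) t - G (a (j + 2)) (b (j + 2)) (1 - t))"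
  define h where "h = (\<lambda>t. a (j + 1) * t + b (j + 1) * t\<^sup>2
    + (a (j + 2) * (1 - t) + b (j + 2) * (1 - t)\<^sup>2))"
  have H: "(H has_real_derivative h t) (at t within {0..1})" for t
  proof -
    have "((\<lambda>t. G a b (1 - t)) has_real_derivative - (a * (1 - t) + b * (1 - t)\<^sup>2)) (at t)" for a b
      using DERIV_chain2[OF G, of "\<lambda>t. 1 - t" "- 1" t UNIV a b]
      by (simp add: DERIV_diff[OF DERIV_const DERIV_ident, of 1 t UNIV, simplified])
    from DERIV_diff[OF G this] have "(H has_real_derivative h t) (at t)"
      unfolding H_def h_def diff_minus_eq_add .
    then show ?thesis by (rule has_field_derivative_at_within)
  qed
  have "(h has_integral H 1 - H 0) {0..1}"
    by (rule fundamental_theorem_of_calculus)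
      (simp_all add: H flip: has_real_derivative_iff_has_vector_derivative)
  then have "integral {0..1} h = H 1 - H 0" by (rule integral_unique)
  also have "\<dots> = (a (j + 1) / 2 + b (j + 1) / 3) + (a (j + 2) / 2 + b (j + 2) / 3)"
    by (simp add: H_def G_def)
  also have "integral {0..1} h =
    I_CR v j (\<lambda>x\<in>triangle_of v. \<Sum>i\<in>UNIV. a i * bary v i x + b i * (bary v i x)\<^sup>2)"
    unfolding I_CR_def
  proof (rule integral_cong)
    fix t :: real assume "t \<in> {0..1}"
    \<comment> \<open>The restricted function obeys its formula only inside the triangle.\<close>
    note mem = edge_in_triangle[OF this, of v "j + 1" "j + 2"]
    show "h t = (\<lambda>x\<in>triangle_of v. \<Sum>i\<in>UNIV. a i * bary v i x + b i * (bary v i x)\<^sup>2)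
      (t *\<^sub>R v (j + 1) + (1 - t) *\<^sub>R v (j + 2))"
      unfolding restrict_apply'[OF mem] sum_3_shift[of _ j] bary_edge[OF assms] h_def by simp
  qed
  finally show ?thesis .
qed

lemma phi_combination_eq:
  assumes "counterclockwise v"
  shows "(\<lambda>x\<in>triangle_of v. \<Sum>i\<in>UNIV. c i * \<phi> v i x) =
    (\<lambda>x\<in>triangle_of v. \<Sum>i\<in>UNIV. (- 2 * c i) * bary v i x + (3 * c i) * (bary v i x)\<^sup>2)"
  unfolding phi_eq[OF assms]
  by (intro restrict_ext sum.cong) (simp_all add: algebra_simps)

lemma I_CR_kernel_P2:
  assumes ccw: "counterclockwise v"
  shows "p \<in> P2 v \<and> (\<forall>j. I_CR v j p = 0) \<longleftrightarrow>
    (\<exists>c. p = (\<lambda>x\<in>triangle_of v. \<Sum>i\<in>UNIV. c i * \<phi> v i x))" (is "?L \<longleftrightarrow> ?R")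
proof
  assume ?L
  then obtain a b where p:
    "p = (\<lambda>x\<in>triangle_of v. \<Sum>i\<in>UNIV. a i * bary v i x + b i * (bary v i x)\<^sup>2)"
    unfolding P2_def by blast
  \<comment> \<open>\<open>d i\<close> is the contribution of vertex \<open>i\<close> to the mean
    over either edge that contains it.\<close>
  define d where "d = (\<lambda>i. a i / 2 + b i / 3)"
  have "d (j + 1) + d (j + 2) = 0" for j
    using \<open>?L\<close> I_CR_quadratic[OF ccw, of j a b] unfolding p d_def by simp
  \<comment> \<open>Adding two of the pairwise sums and subtracting the third isolates twice one of
    the numbers.\<close>
  from this[of 1] this[of 2] this[of 3] have "d 1 = 0 \<and> d 2 = 0 \<and> d 3 = 0"
    unfolding succ_3 by linarith
  then have "d i = 0" for i using exhaust_3[of i] by auto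
  then have a: "a i = - 2 * (b i / 3)" for i by (simp add: d_def field_simps eq_neg_iff_add_eq_0)
  \<comment> \<open>The factor \<open>b i / 3\<close> is forced by the leading coefficient 3 of
    \<open>\<phi> v i\<close>; the linear terms then agree because \<open>d i = 0\<close>.\<close>
  have "p = (\<lambda>x\<in>triangle_of v. \<Sum>i\<in>UNIV. (b i / 3) * \<phi> v i x)"
    unfolding p phi_combination_eq[OF ccw] a by simp
  then show ?R by (rule exI[of _ "\<lambda>i. b i / 3"])
next
  assume ?R
  then obtain c where p: "p = (\<lambda>x\<in>triangle_of v. \<Sum>i\<in>UNIV. c i * \<phi> v i x)" by blast
  have "I_CR v j p = 0" for j
    unfolding p phi_combination_eq[OF ccw] I_CR_quadratic[OF ccw] by simp
  moreover have "p \<in> P2 v"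
    unfolding p phi_combination_eq[OF ccw] P2_def mem_Collect_eq
    by (rule exI[of _ "\<lambda>i. - 2 * c i"], rule exI[of _ "\<lambda>i. 3 * c i"]) simp
  ultimately show ?L by blast
qed

lemma phi_combination_eq_0_iff:
  assumes "counterclockwise v"
  shows "(\<lambda>x\<in>triangle_of v. \<Sum>i\<in>UNIV. c i * \<phi> v i x) = (\<lambda>x\<in>triangle_of v. 0)
    \<longleftrightarrow> (\<forall>i. c i = 0)" (is "?L \<longleftrightarrow> ?R")
proof
  assume ?L
  have "c k = 0" for k
    using fun_cong[OF \<open>?L\<close>, of "v k"] by (simp add: vertex_in_triangle phi_vertex[OF assms])
  then show ?R ..
qed simp

theorem theorem2p4:
  fixes v :: "3 \<Rightarrow> real^2"
    and T :: "(real^2) set"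
    and F :: "3 \<Rightarrow> (real^2 \<Rightarrow> real) \<Rightarrow> real"
  assumes "\<not> collinear (range v)"
    and "counterclockwise v"
    and "T = triangle_of v"
    and "\<And>j. linear_functional T (F j)"
  shows "finite_element (T, P2 v, range (I_CR v) \<union> range F)
     \<longleftrightarrow> invertible (\<chi> j i. F j (\<phi> v i))"
proof -
  let ?N = "\<chi> j i. F j (\<phi> v i)"
  let ?comb = "\<lambda>c. \<lambda>x\<in>T. \<Sum>i\<in>UNIV. c i * \<phi> v i x"
  have F_comb: "F j (?comb c) = (?N *v (\<chi> i. c i)) $ j" for j c
    using linear_functional_sum[OF assms(4), of UNIV "\<phi> v" j c] phi_in_cont_funs[OF assms(2)]
    by (simp add: assms(3) matrix_vector_mult_def mult.commute)
  have F_comb_0: "(\<forall>j. F j (?comb c) = 0) \<longleftrightarrow> ?N *v (\<chi> i. c i) = 0" for c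
    by (simp only: F_comb vec_eq_iff zero_index)
  have comb_0: "?comb c = (\<lambda>x\<in>T. 0) \<longleftrightarrow> (\<chi> i. c i) = (0 :: real^3)" for c
    by (simp only: assms(3) phi_combination_eq_0_iff[OF assms(2)] vec_eq_iff zero_index vec_lambda_beta)
  have kernel: "p \<in> P2 v \<and> (\<forall>j. I_CR v j p = 0) \<longleftrightarrow> (\<exists>c. p = ?comb c)" for p
    by (simp only: assms(3) I_CR_kernel_P2[OF assms(2)])
  have "finite_element (T, P2 v, range (I_CR v) \<union> range F) \<longleftrightarrow>
    (\<forall>p. (p \<in> P2 v \<and> (\<forall>j. I_CR v j p = 0)) \<longrightarrow> (\<forall>j. F j p = 0) \<longrightarrow> p = (\<lambda>x\<in>T. 0))"
    unfolding finite_element_def by auto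
  \<comment> \<open>Polynomials with vanishing edge means are now parametrized by their coefficients
    \<open>c\<close>.\<close>
  also have "\<dots> \<longleftrightarrow> (\<forall>c. (\<forall>j. F j (?comb c) = 0) \<longrightarrow> ?comb c = (\<lambda>x\<in>T. 0))"
    unfolding kernel by blast
  also have "\<dots> \<longleftrightarrow> (\<forall>c. ?N *v (\<chi> i. c i) = 0 \<longrightarrow> (\<chi> i. c i) = (0 :: real^3))"
    by (simp only: F_comb_0 comb_0)
  also have "\<dots> \<longleftrightarrow> (\<forall>w. ?N *v w = 0 \<longrightarrow> w = 0)"
  proof (intro iffI allI)
    fix w
    assume "\<forall>c. ?N *v (\<chi> i. c i) = 0 \<longrightarrow> (\<chi> i. c i) = (0 :: real^3)"
    from spec[OF this, of "vec_nth w"] show "?N *v w = 0 \<longrightarrow> w = 0"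
      by (simp only: vec_lambda_eta)
  qed blast
  \<comment> \<open>A trivial kernel gives a left inverse, which for a square matrix is
    two-sided.\<close>
  also have "\<dots> \<longleftrightarrow> invertible ?N"
    by (simp add: invertible_left_inverse matrix_left_invertible_ker)
  finally show ?thesis .
qed

end
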